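(* Let $\Gamma=\Gamma(B)$ be the quiver of a cluster-tilted algebra of simply-laced Dynkin type $\Delta$, and let $\{\gamma_x : x\in\Gamma_0\}\subseteq\Phi$ be a companion basis for $\Gamma$ giving rise to the positive quasi-Cartan companion $A$ of $B$. Then the companion bases for $\Gamma$ that give rise to $A$ are precisely the sets of the form $\{w\sigma\gamma_x : x\in\Gamma_0\}$ (with $w\sigma\gamma_x$ the element indexed by $x$), where $w\in W_\Phi$ and $\sigma$ is an orthogonal linear transformation of $V$ that permutes $\Pi$.
   Context: Let $\Delta$ be a Dynkin diagram of type $A_n$, $D_n$, $E_6$, $E_7$ or $E_8$, with $n$ vertices. For a skew-symmetric integer matrix $B=(b_{xy})$ and an index $k$, the mutation of $B$ at $k$ is $B'=(b'_{xy})$ with $b'_{xy}=-b_{xy}$ if $x=k$ or $y=k$, and $b'_{xy}=b_{xy}+\frac{|b_{xk}|b_{ky}+b_{xk}|b_{ky}|}{2}$ otherwise; mutation equivalence means being connected by finitely many mutations. The Cartan counterpart of $B$ has diagonal entries $2$ and off-diagonal entries $-|b_{xy}|$. Fix a skew-symmetric integer matrix $B$, with rows and columns indexed by an $n$-element set $\Gamma_0$, which is an exchange matrix of the cluster algebra of type $\Delta$, i.e. $B$ is mutation equivalent to a matrix $B_0$ whose Cartan counterpart is the Cartan matrix of type $\Delta$. (All entries of $B$ then lie in $\{0,\pm1\}$.) Let $\Gamma=\Gamma(B)$ be the quiver with vertex set $\Gamma_0$ and an arrow $x\to y$ whenever $b_{xy}>0$; these are exactly the quivers of the cluster-tilted algebras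 of type $\Delta$. Let $V$ be a Euclidean space with positive definite symmetric bilinear form $(\;,\;)$, and let $\Phi\subseteq V$ be the root system of type $\Delta$ (spanning $V$), normalised so that $(\alpha,\alpha)=2$ for every root. Let $\Pi=\{\alpha_1,\dots,\alpha_n\}$ be a simple system of $\Phi$ and let $W_\Phi$ be the Weyl group. A quasi-Cartan companion of $B$ is a (here symmetric) integer matrix $A=(a_{xy})$ with $a_{xx}=2$ for all $x$ and $|a_{xy}|=|b_{xy}|$ for all $x\ne y$; it is positive if it is positive definite. A companion basis for $\Gamma$ giving rise to $A$ is a subset $\{\gamma_x:x\in\Gamma_0\}\subseteq\Phi$, indexed by $\Gamma_0$, which is a $\mathbb Z$-basis of $\mathbb Z\Phi$ and is such that the matrix $A=(a_{xy})$ with $a_{xy}=(\gamma_x,\gamma_y)$ is a positive quasi-Cartan companion of $B$. *)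

theory Defs
  imports
    "HOL-Analysis.Analysis"
    "HOL-Algebra.Bij"
    "HOL-Algebra.Generated_Groups"
    "HOL-Computational_Algebra.Group_Closure"
begin

text \<open>Simply-laced Dynkin diagrams and their Cartan matrices\<close>

datatype dynkin = Dyn_A nat | Dyn_D nat | Dyn_E6 | Dyn_E7 | Dyn_E8

fun rank :: "dynkin \<Rightarrow> nat" where
  "rank (Dyn_A n) = n"
| "rank (Dyn_D n) = n"
| "rank Dyn_E6 = 6"
| "rank Dyn_E7 = 7"
| "rank Dyn_E8 = 8"

fun admissible :: "dynkin \<Rightarrow> bool" where
  "admissible (Dyn_A n) \<longleftrightarrow> n \<ge> 1"
| "admissible (Dyn_D n) \<longleftrightarrow> n \<ge> 4"
| "admissible _ \<longleftrightarrow> True"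

text \<open>The vertices are \<open>0, \<dots>, rank \<Delta> - 1\<close>. In types D and E the last vertex is the short
  branch attached to a chain formed by all the other vertices.\<close>

definition chain :: "nat \<Rightarrow> nat set set" where
  "chain m = {{i, Suc i} | i. Suc i < m}"

fun edges :: "dynkin \<Rightarrow> nat set set" where
  "edges (Dyn_A n) = chain n"
| "edges (Dyn_D n) = insert {n - 3, n - 1} (chain (n - 1))"
| "edges Dyn_E6 = insert {2, 5} (chain 5)"
| "edges Dyn_E7 = insert {2, 6} (chain 6)"
| "edges Dyn_E8 = insert {2, 7} (chain 7)"

definition cartan_matrix :: "dynkin \<Rightarrow> nat \<Rightarrow> nat \<Rightarrow> int" where
  "cartan_matrix \<Delta> i j = (if i = j then 2 else if {i, j} \<in> edges \<Delta> then - 1 else 0)"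

text \<open>Matrix mutation and exchange matrices\<close>

definition skew_symmetric :: "int^'n^'n \<Rightarrow> bool" where
  "skew_symmetric B \<longleftrightarrow> transpose B = - B"

text \<open>The integer division by 2 is exact: the dividend is \<open>0\<close> or \<open>\<plusminus> 2 * B $ x $ k * B $ k $ y\<close>.\<close>

definition mutation :: "'n \<Rightarrow> int^'n^'n \<Rightarrow> int^'n^'n" where
  "mutation k B = (\<chi> x y. if x = k \<or> y = k then - (B $ x $ y)
     else B $ x $ y + (\<bar>B $ x $ k\<bar> * B $ k $ y + B $ x $ k * \<bar>B $ k $ y\<bar>) div 2)"

definition mutation_equivalent :: "int^'n^'n \<Rightarrow> int^'n^'n \<Rightarrow> bool" where
  "mutation_equivalent = (\<lambda>B C. \<exists>k. C = mutation k B)\<^sup>*\<^sup>*"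

definition cartan_counterpart :: "int^'n^'n \<Rightarrow> int^'n^'n" where
  "cartan_counterpart B = (\<chi> x y. if x = y then 2 else - \<bar>B $ x $ y\<bar>)"

text \<open>The bijection \<open>e\<close> numbers the index set by the vertices of \<open>\<Delta>\<close>; it forces
  \<open>CARD('n) = rank \<Delta>\<close>.\<close>

definition exchange_matrix_of_type :: "dynkin \<Rightarrow> int^'n^'n \<Rightarrow> bool" where
  "exchange_matrix_of_type \<Delta> B \<longleftrightarrow> skew_symmetric B \<and>
     (\<exists>B\<^sub>0 e. skew_symmetric B\<^sub>0 \<and> mutation_equivalent B B\<^sub>0 \<and> bij_betw e UNIV {..<rank \<Delta>} \<and>
        (\<forall>x y. cartan_counterpart B\<^sub>0 $ x $ y = cartan_matrix \<Delta> (e x) (e y)))"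

text \<open>Root systems\<close>

definition reflection :: "'v::real_inner \<Rightarrow> 'v \<Rightarrow> 'v" where
  "reflection \<alpha> v = v - (2 * (v \<bullet> \<alpha>) / (\<alpha> \<bullet> \<alpha>)) *\<^sub>R \<alpha>"

definition root_system :: "'v::euclidean_space set \<Rightarrow> bool" where
  "root_system \<Phi> \<longleftrightarrow> finite \<Phi> \<and> 0 \<notin> \<Phi> \<and> span \<Phi> = UNIV \<and>
     (\<forall>\<alpha>\<in>\<Phi>. {c *\<^sub>R \<alpha> | c. c *\<^sub>R \<alpha> \<in> \<Phi>} = {\<alpha>, - \<alpha>}) \<and>
     (\<forall>\<alpha>\<in>\<Phi>. reflection \<alpha> ` \<Phi> = \<Phi>) \<and>
     (\<forall>\<alpha>\<in>\<Phi>. \<forall>\<beta>\<in>\<Phi>. 2 * (\<beta> \<bullet> \<alpha>) / (\<alpha> \<bullet> \<alpha>) \<in> \<int>)"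

definition simple_system :: "'v::euclidean_space set \<Rightarrow> 'v set \<Rightarrow> bool" where
  "simple_system \<Phi> S \<longleftrightarrow> S \<subseteq> \<Phi> \<and> independent S \<and> span S = UNIV \<and>
     (\<forall>\<beta>\<in>\<Phi>. \<exists>c :: 'v \<Rightarrow> nat. \<beta> = (\<Sum>\<alpha>\<in>S. real (c \<alpha>) *\<^sub>R \<alpha>) \<or> \<beta> = - (\<Sum>\<alpha>\<in>S. real (c \<alpha>) *\<^sub>R \<alpha>))"

definition root_system_of_type :: "dynkin \<Rightarrow> 'v::euclidean_space set \<Rightarrow> bool" where
  "root_system_of_type \<Delta> \<Phi> \<longleftrightarrow> root_system \<Phi> \<and>
     (\<exists>S a. simple_system \<Phi> S \<and> bij_betw a {..<rank \<Delta>} S \<and>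
        (\<forall>i<rank \<Delta>. \<forall>j<rank \<Delta>.
           2 * (a i \<bullet> a j) / (a j \<bullet> a j) = of_int (cartan_matrix \<Delta> i j)))"

definition weyl_group :: "'v::euclidean_space set \<Rightarrow> ('v \<Rightarrow> 'v) set" where
  "weyl_group \<Phi> = generate (BijGroup UNIV) (reflection ` \<Phi>)"

text \<open>Companion bases\<close>

definition quasi_cartan_companion :: "int^'n^'n \<Rightarrow> int^'n^'n \<Rightarrow> bool" where
  "quasi_cartan_companion B A \<longleftrightarrow> transpose A = A \<and> (\<forall>x. A $ x $ x = 2) \<and>
     (\<forall>x y. x \<noteq> y \<longrightarrow> \<bar>A $ x $ y\<bar> = \<bar>B $ x $ y\<bar>)"

definition positive_definite :: "int^'n^'n \<Rightarrow> bool" where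
  "positive_definite A \<longleftrightarrow> transpose A = A \<and>
     (\<forall>v :: real^'n. v \<noteq> 0 \<longrightarrow> (\<Sum>x\<in>UNIV. \<Sum>y\<in>UNIV. v $ x * of_int (A $ x $ y) * v $ y) > 0)"

text \<open>The family \<open>g\<close>, indexed by the whole type \<open>'n\<close>, is a basis of the abelian group \<open>L\<close>.\<close>

definition Z_basis :: "('n::finite \<Rightarrow> 'v::real_vector) \<Rightarrow> 'v set \<Rightarrow> bool" where
  "Z_basis g L \<longleftrightarrow> group_closure (range g) = L \<and>
     (\<forall>c :: 'n \<Rightarrow> int. (\<Sum>x\<in>UNIV. of_int (c x) *\<^sub>R g x) = 0 \<longrightarrow> (\<forall>x. c x = 0))"

text \<open>The quiver enters only through the exchange matrix \<open>B\<close>. A companion basis is an indexed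
  family, so two of them are equal when they agree at every vertex.\<close>

definition companion_basis_giving_rise_to ::
    "'v::euclidean_space set \<Rightarrow> int^'n^'n \<Rightarrow> int^'n^'n \<Rightarrow> ('n \<Rightarrow> 'v) \<Rightarrow> bool" where
  "companion_basis_giving_rise_to \<Phi> B A g \<longleftrightarrow>
     range g \<subseteq> \<Phi> \<and> Z_basis g (group_closure \<Phi>) \<and>
     (\<forall>x y. of_int (A $ x $ y) = g x \<bullet> g y) \<and>
     quasi_cartan_companion B A \<and> positive_definite A"

end

theory Submission
  imports Defs
begin

text \<open>Two companion bases with the same matrix of inner products differ by a unique orthogonal
  transformation \<open>\<rho>\<close>: positive definiteness makes the first one a vector space basis, and a linear
  map that preserves the inner products of a basis is orthogonal. Both families generate the root
  lattice, so \<open>\<rho>\<close> maps the lattice onto itself. In the simply-laced case the roots are precisely the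
  lattice vectors of squared norm 2 (\<open>lattice_norm2_root\<close>), hence \<open>\<rho>\<close> permutes the roots
  (\<open>isometry_preserves_roots\<close>) and maps the simple system \<open>S\<close> to another simple system. The Weyl
  group acts transitively on simple systems (\<open>weyl_group_transitive_on_simple_systems\<close>), so that
  \<open>\<rho>\<close> and some Weyl group element \<open>w\<close> have the same effect on \<open>S\<close> as a set, and \<open>\<rho>\<close> is \<open>w\<close> after an orthogonal
  permutation \<open>\<sigma>\<close> of \<open>S\<close>.

  Conversely, an orthogonal permutation of \<open>S\<close> preserves the lattice generated by \<open>S\<close>, which is
  the root lattice, and therefore the roots. Any orthogonal transformation that preserves the roots
  carries companion bases to companion bases with the same inner products.\<close>

section \<open>Integral spans\<close>

lemma group_closure_mono:
  assumes "X \<subseteq> group_closure Y"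
  shows "group_closure X \<subseteq> group_closure Y"
proof
  fix x assume "x \<in> group_closure X"
  then show "x \<in> group_closure Y"
    by induction (use assms in \<open>auto intro: group_closure.diff\<close>)
qed

lemma group_closure_linear_image:
  fixes f :: "'v::real_vector \<Rightarrow> 'w::real_vector"
  assumes "linear f"
  shows "group_closure (f ` X) = f ` group_closure X"
proof
  show "group_closure (f ` X) \<subseteq> f ` group_closure X"
  proof
    fix y assume "y \<in> group_closure (f ` X)"
    then show "y \<in> f ` group_closure X"
    proof induction
      case (base s)
      then show ?case
        using linear_0[OF assms] by (auto simp: image_iff intro: group_closure.base bexI[of _ 0])
    next
      case (diff s t)
      then show ?case
        by (auto simp: linear_diff[OF assms, symmetric] intro: group_closure.diff)
    qed
  qed
next
  have "f x \<in> group_closure (f ` X)" if "x \<in> group_closure X" for x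
    using that
    by induction (auto simp: linear_0[OF assms] linear_diff[OF assms]
        intro: group_closure.intros)
  then show "f ` group_closure X \<subseteq> group_closure (f ` X)" by blast
qed

lemma group_closure_of_nat_scale:
  fixes x :: "'v::real_vector"
  assumes "x \<in> group_closure X"
  shows "real n *\<^sub>R x \<in> group_closure X"
  by (induction n) (auto simp: scaleR_left_distrib assms intro: group_closure_add)

lemma group_closure_sum_nat:
  fixes X :: "'v::real_vector set"
  assumes "Y \<subseteq> X"
  shows "(\<Sum>x\<in>Y. real (c x) *\<^sub>R x) \<in> group_closure X"
  using assms
  by (induction Y rule: infinite_finite_induct)
    (auto intro!: group_closure_add group_closure_of_nat_scale intro: group_closure.base)

lemma span_group_closure: "group_closure X \<subseteq> span X"
proof
  fix x assume "x \<in> group_closure X"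
  then show "x \<in> span X"
    by induction (auto intro: span_base span_zero span_diff)
qed

section \<open>Root systems and simple systems\<close>

lemma linear_reflection: "linear (reflection \<alpha>)"
  by (rule linearI)
    (auto simp: reflection_def algebra_simps add_divide_distrib inner_add_left)

lemma orthogonal_transformation_reflection:
  "orthogonal_transformation (reflection \<alpha>)"
proof (cases "\<alpha> = 0")
  case True
  then show ?thesis by (simp add: reflection_def[abs_def])
next
  case False
  then show ?thesis
    unfolding orthogonal_transformation_def
    by (auto simp: linear_reflection)
      (simp add: reflection_def inner_diff_left inner_diff_right inner_commute field_simps)
qed

lemma reflection_self: "\<alpha> \<noteq> 0 \<Longrightarrow> reflection \<alpha> \<alpha> = - \<alpha>"
  by (simp add: reflection_def) (metis scaleR_2 add_diff_cancel_left' minus_diff_eq)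

lemma root_system_uminus:
  assumes "root_system \<Phi>" "\<alpha> \<in> \<Phi>"
  shows "- \<alpha> \<in> \<Phi>"
proof -
  have "reflection \<alpha> \<alpha> \<in> \<Phi>" "\<alpha> \<noteq> 0"
    using assms unfolding root_system_def by blast+
  then show ?thesis by (simp add: reflection_self)
qed

lemma simple_system_finite: "simple_system \<Phi> S \<Longrightarrow> finite S"
  by (auto simp: simple_system_def independent_imp_finite)

lemma simple_system_combination:
  assumes "simple_system \<Phi> S" "\<beta> \<in> \<Phi>"
  obtains c :: "'v::euclidean_space \<Rightarrow> nat"
  where "\<beta> = (\<Sum>\<alpha>\<in>S. real (c \<alpha>) *\<^sub>R \<alpha>) \<or> \<beta> = - (\<Sum>\<alpha>\<in>S. real (c \<alpha>) *\<^sub>R \<alpha>)"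
  using assms unfolding simple_system_def by metis

lemma simple_system_group_closure:
  assumes "simple_system \<Phi> S"
  shows "group_closure S = group_closure \<Phi>"
proof
  show "group_closure S \<subseteq> group_closure \<Phi>"
    using assms by (intro group_closure_mono) (auto simp: simple_system_def intro: group_closure.base)
  have "\<beta> \<in> group_closure S" if "\<beta> \<in> \<Phi>" for \<beta>
  proof -
    obtain c :: "_ \<Rightarrow> nat" where "\<beta> = (\<Sum>\<alpha>\<in>S. real (c \<alpha>) *\<^sub>R \<alpha>) \<or> \<beta> = - (\<Sum>\<alpha>\<in>S. real (c \<alpha>) *\<^sub>R \<alpha>)"
      using simple_system_combination[OF assms \<open>\<beta> \<in> \<Phi>\<close>] by blast
    then show ?thesis
      using group_closure_sum_nat[of S S c] by auto
  qed
  then show "group_closure \<Phi> \<subseteq> group_closure S"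
    by (intro group_closure_mono) auto
qed

lemma group_closure_coordinates:
  fixes S :: "'v::real_vector set"
  assumes "finite S" "v \<in> group_closure S"
  shows "\<exists>c :: 'v \<Rightarrow> int. v = (\<Sum>\<alpha>\<in>S. of_int (c \<alpha>) *\<^sub>R \<alpha>)"
  using assms(2)
proof induction
  case (base s)
  show ?case
  proof (cases "s = 0")
    case True
    then show ?thesis by (intro exI[of _ "\<lambda>_. 0"]) simp
  next
    case False
    then have "s \<in> S" using base by auto
    then have "(\<Sum>\<alpha>\<in>S. of_int (if \<alpha> = s then 1 else 0) *\<^sub>R \<alpha>) = s"
      using assms(1) by (simp add: if_distrib[of "\<lambda>n. n *\<^sub>R _"] if_distrib[of of_int] sum.delta cong: if_cong)
    then show ?thesis by metis
  qed
next
  case (diff s t)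
  then obtain c d :: "'v \<Rightarrow> int" where "s = (\<Sum>\<alpha>\<in>S. of_int (c \<alpha>) *\<^sub>R \<alpha>)"
    "t = (\<Sum>\<alpha>\<in>S. of_int (d \<alpha>) *\<^sub>R \<alpha>)" by auto
  then show ?case
    by (intro exI[of _ "\<lambda>\<alpha>. c \<alpha> - d \<alpha>"]) (simp add: sum_subtractf scaleR_left_diff_distrib)
qed

text \<open>The coefficients of a root with respect to the image are those of its preimage with respect
  to the original simple system.\<close>

lemma simple_system_image:
  assumes S: "simple_system \<Phi> S" and f: "linear f" "inj f" and \<Phi>: "f ` \<Phi> = \<Phi>"
  shows "simple_system \<Phi> (f ` S)"
  unfolding simple_system_def
proof (intro conjI ballI)
  show "f ` S \<subseteq> \<Phi>" using S \<Phi> by (auto simp: simple_system_def)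
  show "independent (f ` S)"
    using S f inj_on_subset[OF f(2)]
    by (intro linear_independent_injective_image) (auto simp: simple_system_def)
  have "surj f" using f by (simp add: linear_injective_imp_surjective)
  then show "span (f ` S) = UNIV"
    using S f by (simp add: simple_system_def linear_span_image)
  fix \<beta> assume "\<beta> \<in> \<Phi>"
  then obtain \<beta>' where \<beta>': "\<beta>' \<in> \<Phi>" "\<beta> = f \<beta>'" using \<Phi> by auto
  obtain c :: "_ \<Rightarrow> nat" where c:
    "\<beta>' = (\<Sum>\<alpha>\<in>S. real (c \<alpha>) *\<^sub>R \<alpha>) \<or> \<beta>' = - (\<Sum>\<alpha>\<in>S. real (c \<alpha>) *\<^sub>R \<alpha>)"
    using simple_system_combination[OF S \<beta>'(1)] by blast
  have "f (\<Sum>\<alpha>\<in>S. real (c \<alpha>) *\<^sub>R \<alpha>) = (\<Sum>\<alpha>\<in>f ` S. real ((c \<circ> inv_into UNIV f) \<alpha>) *\<^sub>R \<alpha>)"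
    using f by (simp add: linear_sum linear_scale sum.reindex inj_on_subset[OF f(2)])
  then show "\<exists>c :: _ \<Rightarrow> nat. \<beta> = (\<Sum>\<alpha>\<in>f ` S. real (c \<alpha>) *\<^sub>R \<alpha>) \<or> \<beta> = - (\<Sum>\<alpha>\<in>f ` S. real (c \<alpha>) *\<^sub>R \<alpha>)"
    using c \<beta>' f by (metis linear_neg)
qed

text \<open>A vector pairing to 1 with every simple root measures the height of a root. It also lies in
  the open fundamental chamber, and it serves below as the base point whose orbit under the Weyl
  group is studied.\<close>

lemma simple_system_height_vector:
  fixes S :: "'v::euclidean_space set"
  assumes "independent S"
  obtains d where "\<And>\<alpha>. \<alpha> \<in> S \<Longrightarrow> d \<bullet> \<alpha> = 1"
proof -
  obtain g :: "'v \<Rightarrow> real" where g: "linear g" "\<forall>\<alpha>\<in>S. g \<alpha> = 1"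
    using linear_independent_extend[OF assms, of "\<lambda>_. 1 :: real"] by auto
  have "adjoint g 1 \<bullet> \<alpha> = 1" if "\<alpha> \<in> S" for \<alpha>
    using adjoint_works[OF g(1), of \<alpha> 1] g(2) that by (simp add: inner_commute)
  then show ?thesis by (rule that)
qed

text \<open>The height of a root is up to sign a sum of natural numbers, not all zero because
  0 is not a root. Hence no root is orthogonal to the height vector, and the positive ones have
  height at least 1.\<close>

lemma root_height:
  assumes \<Phi>: "root_system \<Phi>" and S: "simple_system \<Phi> S" and d: "\<And>\<alpha>. \<alpha> \<in> S \<Longrightarrow> d \<bullet> \<alpha> = 1"
    and \<beta>: "\<beta> \<in> \<Phi>"
  shows "\<bar>d \<bullet> \<beta>\<bar> \<ge> 1"
proof -
  obtain c :: "_ \<Rightarrow> nat" where c: "\<beta> = (\<Sum>\<alpha>\<in>S. real (c \<alpha>) *\<^sub>R \<alpha>) \<or> \<beta> = - (\<Sum>\<alpha>\<in>S. real (c \<alpha>) *\<^sub>R \<alpha>)"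
    using simple_system_combination[OF S \<beta>] by blast
  have *: "d \<bullet> (\<Sum>\<alpha>\<in>S. real (c \<alpha>) *\<^sub>R \<alpha>) = real (\<Sum>\<alpha>\<in>S. c \<alpha>)"
    by (simp add: inner_sum_right d)
  have "(\<Sum>\<alpha>\<in>S. c \<alpha>) \<noteq> 0"
  proof
    assume "(\<Sum>\<alpha>\<in>S. c \<alpha>) = 0"
    then have "\<beta> = 0" using c simple_system_finite[OF S] by auto
    then show False using \<Phi> \<beta> by (auto simp: root_system_def)
  qed
  then have "real (\<Sum>\<alpha>\<in>S. c \<alpha>) \<ge> 1"
    by linarith
  then show ?thesis using c * by (auto simp del: of_nat_sum)
qed

text \<open>A simple system is determined by its chamber. If all members of \<open>T\<close> are positive with respect
  to \<open>S\<close>, they have height at least 1. A member of \<open>S\<close> has height exactly 1 and is an integral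
  combination of \<open>T\<close> with coefficients of one sign, so precisely one of these coefficients is
  nonzero, and it equals 1.\<close>

lemma simple_system_unique:
  assumes \<Phi>: "root_system \<Phi>" and S: "simple_system \<Phi> S" and T: "simple_system \<Phi> T"
    and d: "\<And>\<alpha>. \<alpha> \<in> S \<Longrightarrow> d \<bullet> \<alpha> = 1" and pos: "\<And>\<beta>. \<beta> \<in> T \<Longrightarrow> d \<bullet> \<beta> > 0"
  shows "S = T"
proof -
  note fT = simple_system_finite[OF T]
  have ge1: "d \<bullet> \<beta> \<ge> 1" if "\<beta> \<in> T" for \<beta>
  proof -
    have "\<beta> \<in> \<Phi>" using T that by (auto simp: simple_system_def)
    then show ?thesis using root_height[OF \<Phi> S d] pos[OF that] by fastforce
  qed
  have "\<alpha> \<in> T" if \<alpha>: "\<alpha> \<in> S" for \<alpha>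
  proof -
    have "\<alpha> \<in> \<Phi>" using S \<alpha> by (auto simp: simple_system_def)
    then obtain c :: "_ \<Rightarrow> nat" where c:
      "\<alpha> = (\<Sum>\<beta>\<in>T. real (c \<beta>) *\<^sub>R \<beta>) \<or> \<alpha> = - (\<Sum>\<beta>\<in>T. real (c \<beta>) *\<^sub>R \<beta>)"
      using simple_system_combination[OF T] by blast
    have "real (\<Sum>\<beta>\<in>T. c \<beta>) \<le> (\<Sum>\<beta>\<in>T. real (c \<beta>) * (d \<bullet> \<beta>))"
      unfolding of_nat_sum
    proof (rule sum_mono)
      fix \<beta> assume "\<beta> \<in> T"
      then show "real (c \<beta>) \<le> real (c \<beta>) * (d \<bullet> \<beta>)"
        using ge1 mult_left_mono[of 1 "d \<bullet> \<beta>" "real (c \<beta>)"] by simp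
    qed
    then have le: "real (\<Sum>\<beta>\<in>T. c \<beta>) \<le> d \<bullet> (\<Sum>\<beta>\<in>T. real (c \<beta>) *\<^sub>R \<beta>)"
      by (simp add: inner_sum_right)
    have \<alpha>_eq: "\<alpha> = (\<Sum>\<beta>\<in>T. real (c \<beta>) *\<^sub>R \<beta>)"
      using c d[OF \<alpha>] le by (smt (verit) inner_minus_right of_nat_0_le_iff)
    have "real (\<Sum>\<beta>\<in>T. c \<beta>) \<le> 1"
      using le d[OF \<alpha>] unfolding \<alpha>_eq[symmetric] by simp
    then have "(\<Sum>\<beta>\<in>T. c \<beta>) \<le> 1" by linarith
    moreover have "(\<Sum>\<beta>\<in>T. c \<beta>) \<noteq> 0"
    proof
      assume "(\<Sum>\<beta>\<in>T. c \<beta>) = 0"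
      then have "\<alpha> = 0" using \<alpha>_eq fT by auto
      then show False using d[OF \<alpha>] by simp
    qed
    ultimately have "(\<Sum>\<beta>\<in>T. c \<beta>) = 1" by linarith
    then obtain \<beta> where \<beta>: "\<beta> \<in> T" "c \<beta> = 1" "\<forall>\<beta>'\<in>T. \<beta>' \<noteq> \<beta> \<longrightarrow> c \<beta>' = 0"
      using fT sum_eq_1_iff[OF fT, of c] by auto
    have "\<alpha> = (\<Sum>\<beta>'\<in>T. if \<beta>' = \<beta> then \<beta> else 0)"
      unfolding \<alpha>_eq using \<beta> by (intro sum.cong) auto
    then show ?thesis using \<beta> fT by simp
  qed
  then have "S \<subseteq> T" by blast
  then show ?thesis
    using S T spanning_subset_independent[of S T] by (auto simp: simple_system_def)
qed

section \<open>The Weyl group\<close>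

lemma reflection_in_Bij: "reflection (\<alpha> :: 'v::euclidean_space) \<in> Bij UNIV"
  using orthogonal_transformation_bij[OF orthogonal_transformation_reflection[of \<alpha>]]
  by (simp add: Bij_def)

lemma weyl_group_Bij:
  assumes "w \<in> weyl_group \<Phi>"
  shows "w \<in> Bij UNIV"
proof -
  have "reflection ` \<Phi> \<subseteq> carrier (BijGroup UNIV)"
    by (auto simp: BijGroup_def reflection_in_Bij)
  then have "w \<in> carrier (BijGroup UNIV)"
    using assms group.generate_in_carrier[OF group_BijGroup] unfolding weyl_group_def by blast
  then show ?thesis by (simp add: BijGroup_def)
qed

lemma weyl_group_one: "(\<lambda>x. x) \<in> weyl_group \<Phi>"
proof -
  have "\<one>\<^bsub>BijGroup UNIV\<^esub> = (\<lambda>x :: 'a. x)" by (simp add: BijGroup_def restrict_def)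
  then show ?thesis using generate.one unfolding weyl_group_def by metis
qed

lemma weyl_group_reflection_comp:
  assumes "\<alpha> \<in> \<Phi>" "w \<in> weyl_group \<Phi>"
  shows "(\<lambda>x. reflection \<alpha> (w x)) \<in> weyl_group \<Phi>"
proof -
  have "reflection \<alpha> \<otimes>\<^bsub>BijGroup UNIV\<^esub> w \<in> weyl_group \<Phi>"
    using assms unfolding weyl_group_def by (intro generate.eng[OF generate.incl]) auto
  moreover have "reflection \<alpha> \<otimes>\<^bsub>BijGroup UNIV\<^esub> w = (\<lambda>x. reflection \<alpha> (w x))"
    using weyl_group_Bij[OF assms(2)] by (simp add: BijGroup_def reflection_in_Bij compose_def restrict_def)
  ultimately show ?thesis by simp
qed

lemma weyl_group_orthogonal:
  assumes \<Phi>: "root_system \<Phi>" and w: "w \<in> weyl_group \<Phi>"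
  shows "orthogonal_transformation w \<and> w ` \<Phi> = \<Phi>"
  using w unfolding weyl_group_def
proof induction
  case one
  then show ?case by (simp add: BijGroup_def)
next
  case (incl h)
  then obtain \<alpha> where "\<alpha> \<in> \<Phi>" "h = reflection \<alpha>" by auto
  then show ?case
    using \<Phi> by (simp add: orthogonal_transformation_reflection root_system_def)
next
  case (inv h)
  then obtain \<alpha> where \<alpha>: "\<alpha> \<in> \<Phi>" "h = reflection \<alpha>" by auto
  have "inv\<^bsub>BijGroup UNIV\<^esub> h = inv_into UNIV h"
    using inv_BijGroup[of h UNIV] \<alpha> reflection_in_Bij[of \<alpha>] by (simp add: restrict_def)
  moreover have "orthogonal_transformation h" "h ` \<Phi> = \<Phi>"
    using \<alpha> \<Phi> by (simp_all add: orthogonal_transformation_reflection root_system_def)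
  ultimately show ?case
    by (metis orthogonal_transformation_inv orthogonal_transformation_inj image_inv_f_f)
next
  case (eng h1 h2)
  then have "h1 \<in> Bij UNIV" "h2 \<in> Bij UNIV" using weyl_group_Bij by (auto simp: weyl_group_def)
  then have "h1 \<otimes>\<^bsub>BijGroup UNIV\<^esub> h2 = h1 \<circ> h2"
    by (auto simp: BijGroup_def compose_def restrict_def)
  then show ?case
    using eng.IH orthogonal_transformation_compose by (metis image_comp)
qed

text \<open>The roots span, so the image of a vector under \<open>w\<close> is known once the action of \<open>w\<close> on the
  finite set of roots is known.\<close>

lemma finite_weyl_orbit:
  assumes \<Phi>: "root_system \<Phi>"
  shows "finite ((\<lambda>w. w d) ` weyl_group \<Phi>)"
proof -
  have fin: "finite \<Phi>" and sp: "span \<Phi> = UNIV" using \<Phi> by (auto simp: root_system_def)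
  obtain r where r: "d = (\<Sum>\<alpha>\<in>\<Phi>. r \<alpha> *\<^sub>R \<alpha>)"
    using span_finite[OF fin] unfolding sp by fast
  have "(\<lambda>w. w d) ` weyl_group \<Phi> \<subseteq> (\<lambda>f. \<Sum>\<alpha>\<in>\<Phi>. r \<alpha> *\<^sub>R f \<alpha>) ` (\<Phi> \<rightarrow>\<^sub>E \<Phi>)"
  proof clarify
    fix w assume "w \<in> weyl_group \<Phi>"
    then have w: "linear w" "w ` \<Phi> = \<Phi>"
      using weyl_group_orthogonal[OF \<Phi>] orthogonal_transformation_linear by auto
    have "w d = (\<Sum>\<alpha>\<in>\<Phi>. r \<alpha> *\<^sub>R restrict w \<Phi> \<alpha>)"
      by (simp add: r linear_sum[OF w(1)] linear_scale[OF w(1)])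
    moreover have "restrict w \<Phi> \<in> \<Phi> \<rightarrow>\<^sub>E \<Phi>" using w(2) by auto
    ultimately show "w d \<in> (\<lambda>f. \<Sum>\<alpha>\<in>\<Phi>. r \<alpha> *\<^sub>R f \<alpha>) ` (\<Phi> \<rightarrow>\<^sub>E \<Phi>)" by blast
  qed
  then show ?thesis
    by (rule finite_subset) (intro finite_imageI finite_PiE fin)
qed

text \<open>Take height vectors \<open>d\<close> of \<open>S\<close> and \<open>e\<close> of \<open>T\<close>, and choose \<open>w\<close> such that \<open>w d\<close> has the largest
  inner product with \<open>e\<close> in the finite orbit of \<open>d\<close>. Then \<open>w d\<close> lies in the chamber of \<open>T\<close>:
  reflecting it in a member of \<open>T\<close> with which it had a negative inner product would bring it closer
  to \<open>e\<close>. Since \<open>w d\<close> is a height vector of the simple system \<open>w ` S\<close>, the two simple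
  systems share a chamber.\<close>

lemma weyl_group_transitive_on_simple_systems:
  assumes \<Phi>: "root_system \<Phi>" and S: "simple_system \<Phi> S" and T: "simple_system \<Phi> T"
  obtains w where "w \<in> weyl_group \<Phi>" "w ` S = T"
proof -
  obtain d where d: "\<And>\<alpha>. \<alpha> \<in> S \<Longrightarrow> d \<bullet> \<alpha> = 1"
    using S simple_system_height_vector unfolding simple_system_def by metis
  obtain e where e: "\<And>\<alpha>. \<alpha> \<in> T \<Longrightarrow> e \<bullet> \<alpha> = 1"
    using T simple_system_height_vector unfolding simple_system_def by metis
  let ?V = "(\<lambda>v. e \<bullet> v) ` (\<lambda>w. w d) ` weyl_group \<Phi>"
  have "finite ?V" using finite_weyl_orbit[OF \<Phi>] by blast
  moreover have "?V \<noteq> {}" using weyl_group_one by blast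
  ultimately have "Max ?V \<in> ?V" by (rule Max_in)
  then obtain w where w: "w \<in> weyl_group \<Phi>" and eq: "Max ?V = e \<bullet> w d" by auto
  have max: "e \<bullet> w' d \<le> e \<bullet> w d" if "w' \<in> weyl_group \<Phi>" for w'
    unfolding eq[symmetric] using \<open>finite ?V\<close> that by (intro Max_ge) auto
  have ow: "orthogonal_transformation w" and w\<Phi>: "w ` \<Phi> = \<Phi>"
    using weyl_group_orthogonal[OF \<Phi> w] by auto
  have wS: "simple_system \<Phi> (w ` S)"
    using ow w\<Phi> S by (intro simple_system_image)
      (auto simp: orthogonal_transformation_linear orthogonal_transformation_inj)
  have wd: "w d \<bullet> \<alpha> = 1" if "\<alpha> \<in> w ` S" for \<alpha>
    using that d ow by (auto simp: orthogonal_transformation_def)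
  have "w d \<bullet> \<beta> > 0" if \<beta>: "\<beta> \<in> T" for \<beta>
  proof -
    have \<beta>\<Phi>: "\<beta> \<in> \<Phi>" using T \<beta> by (auto simp: simple_system_def)
    then have "\<beta> \<bullet> \<beta> > 0" using \<Phi> by (auto simp: root_system_def)
    \<comment> \<open>The reflection changes \<open>e \<bullet> w d\<close> by a negative multiple of \<open>w d \<bullet> \<beta>\<close>, as \<open>e \<bullet> \<beta> = 1\<close>.\<close>
    have "e \<bullet> reflection \<beta> (w d) \<le> e \<bullet> w d"
      using max[OF weyl_group_reflection_comp[OF \<beta>\<Phi> w]] .
    then have "w d \<bullet> \<beta> \<ge> 0"
      using e[OF \<beta>] \<open>\<beta> \<bullet> \<beta> > 0\<close>
      by (simp add: reflection_def inner_diff_right zero_le_divide_iff)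
    moreover have "\<bar>w d \<bullet> \<beta>\<bar> \<ge> 1" using root_height[OF \<Phi> wS wd \<beta>\<Phi>] .
    ultimately show ?thesis by linarith
  qed
  then have "w ` S = T" using simple_system_unique[OF \<Phi> wS T wd] by blast
  with w show ?thesis by (rule that)
qed

section \<open>Roots as the short vectors of the root lattice\<close>

lemma root_inner_lattice_int:
  assumes \<Phi>: "root_system \<Phi>" and norm2: "\<And>\<alpha>. \<alpha> \<in> \<Phi> \<Longrightarrow> \<alpha> \<bullet> \<alpha> = 2"
    and "v \<in> group_closure \<Phi>" "\<alpha> \<in> \<Phi>"
  shows "v \<bullet> \<alpha> \<in> \<int>"
  using assms(3)
proof induction
  case (base s)
  have "s \<bullet> \<alpha> \<in> \<int>" if "s \<in> \<Phi>"
  proof -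
    have "2 * (s \<bullet> \<alpha>) / (\<alpha> \<bullet> \<alpha>) \<in> \<int>"
      using \<Phi> that assms(4) unfolding root_system_def by blast
    then show ?thesis using norm2[OF assms(4)] by simp
  qed
  then show ?case using base by auto
next
  case (diff s t)
  then show ?case by (simp add: inner_diff_left)
qed

text \<open>Descent on the sum of the absolute values of the coordinates of \<open>v\<close> in the simple roots. Since
  the squared norm of \<open>v\<close> is positive, some simple root, with the sign of its coordinate in \<open>v\<close>,
  has a positive inner product with \<open>v\<close>. Call this signed root \<open>\<delta>\<close>. The inner product is an integer,
  and it is 1 or 2 because \<open>v - \<delta>\<close> has a nonnegative squared norm. If it is 2, then \<open>v = \<delta>\<close>.
  If it is 1, then \<open>v - \<delta>\<close> is the reflection of \<open>v\<close> in \<open>\<delta>\<close>: it again has squared norm 2, and the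
  sum has dropped by 1.\<close>

lemma lattice_norm2_root:
  assumes \<Phi>: "root_system \<Phi>" and norm2: "\<And>\<alpha>. \<alpha> \<in> \<Phi> \<Longrightarrow> \<alpha> \<bullet> \<alpha> = 2"
    and S: "simple_system \<Phi> S" and v: "v \<in> group_closure \<Phi>" "v \<bullet> v = 2"
  shows "v \<in> \<Phi>"
proof -
  note fin = simple_system_finite[OF S]
  have S\<Phi>: "S \<subseteq> \<Phi>" using S by (simp add: simple_system_def)
  obtain c :: "'a \<Rightarrow> int" where "v = (\<Sum>\<alpha>\<in>S. of_int (c \<alpha>) *\<^sub>R \<alpha>)"
    using group_closure_coordinates[OF fin] v(1) simple_system_group_closure[OF S] by blast
  then show ?thesis
    using v
  proof (induction "\<Sum>\<alpha>\<in>S. nat \<bar>c \<alpha>\<bar>" arbitrary: c v rule: less_induct)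
    case less
    have "(\<Sum>\<alpha>\<in>S. of_int (c \<alpha>) * (v \<bullet> \<alpha>)) = v \<bullet> v"
      by (subst (3) less.prems(1)) (simp add: inner_sum_right)
    then have "\<not> (\<Sum>\<alpha>\<in>S. of_int (c \<alpha>) * (v \<bullet> \<alpha>)) \<le> 0" using less.prems by simp
    then obtain \<alpha> where \<alpha>: "\<alpha> \<in> S" "of_int (c \<alpha>) * (v \<bullet> \<alpha>) > 0"
      by (meson not_le sum_nonpos)
    define s where "s = sgn (c \<alpha>)"
    have s: "s = 1 \<or> s = -1" using \<alpha> by (auto simp: s_def sgn_if)
    define \<delta> where "\<delta> = of_int s *\<^sub>R \<alpha>"
    have \<delta>: "\<delta> \<in> \<Phi>" using s \<alpha> S\<Phi> root_system_uminus[OF \<Phi>] by (auto simp: \<delta>_def)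
    have v\<delta>: "v \<bullet> \<delta> > 0"
      using \<alpha> by (auto simp: \<delta>_def s_def sgn_if zero_less_mult_iff)
    have "v \<bullet> \<delta> \<in> \<int>" using root_inner_lattice_int[OF \<Phi> norm2 less.prems(2) \<delta>] .
    then obtain k where k: "v \<bullet> \<delta> = of_int k" by (auto elim: Ints_cases)
    have dist: "(v - \<delta>) \<bullet> (v - \<delta>) = 4 - 2 * (v \<bullet> \<delta>)"
      using less.prems norm2[OF \<delta>] by (simp add: inner_diff_left inner_diff_right inner_commute)
    then have "v \<bullet> \<delta> \<le> 2" using inner_ge_zero[of "v - \<delta>"] by linarith
    then have "k = 1 \<or> k = 2" using k v\<delta> by auto
    then show ?case
    proof
      assume "k = 2"
      then have "v = \<delta>" using dist k by simp
      then show ?thesis using \<delta> by simp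
    next
      assume "k = 1"
      then have v1: "v \<bullet> \<delta> = 1" using k by simp
      define c' where "c' = c(\<alpha> := c \<alpha> - s)"
      have "(\<Sum>\<beta>\<in>S - {\<alpha>}. nat \<bar>c' \<beta>\<bar>) = (\<Sum>\<beta>\<in>S - {\<alpha>}. nat \<bar>c \<beta>\<bar>)"
        by (intro sum.cong) (auto simp: c'_def)
      moreover have "nat \<bar>c' \<alpha>\<bar> < nat \<bar>c \<alpha>\<bar>"
        using \<alpha> by (auto simp: c'_def s_def sgn_if)
      ultimately have lt: "(\<Sum>\<beta>\<in>S. nat \<bar>c' \<beta>\<bar>) < (\<Sum>\<beta>\<in>S. nat \<bar>c \<beta>\<bar>)"
        by (simp add: sum.remove[OF fin \<alpha>(1)])
      have rest: "(\<Sum>\<beta>\<in>S - {\<alpha>}. of_int (c' \<beta>) *\<^sub>R \<beta>) = (\<Sum>\<beta>\<in>S - {\<alpha>}. of_int (c \<beta>) *\<^sub>R \<beta>)"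
        by (intro sum.cong) (auto simp: c'_def)
      have "v - \<delta> = (\<Sum>\<beta>\<in>S. of_int (c' \<beta>) *\<^sub>R \<beta>)"
        unfolding less.prems(1) sum.remove[OF fin \<alpha>(1)] rest
        by (simp add: c'_def \<delta>_def scaleR_left_diff_distrib)
      moreover have "v - \<delta> \<in> group_closure \<Phi>"
        using less.prems(2) \<delta> by (auto intro: group_closure.intros)
      moreover have "(v - \<delta>) \<bullet> (v - \<delta>) = 2" using dist v1 by simp
      ultimately have "v - \<delta> \<in> \<Phi>" using less.hyps[OF lt] by blast
      then have "reflection \<delta> (v - \<delta>) \<in> \<Phi>"
        using \<Phi> \<delta> unfolding root_system_def by blast
      moreover have "reflection \<delta> (v - \<delta>) = v"
        using norm2[OF \<delta>] v1 by (simp add: reflection_def inner_diff_left)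
      ultimately show ?thesis by simp
    qed
  qed
qed

text \<open>The roots are exactly the lattice vectors of squared norm 2, a description that any isometry
  of the lattice respects.\<close>

lemma isometry_preserves_roots:
  assumes \<Phi>: "root_system \<Phi>" and norm2: "\<And>\<alpha>. \<alpha> \<in> \<Phi> \<Longrightarrow> \<alpha> \<bullet> \<alpha> = 2"
    and S: "simple_system \<Phi> S" and f: "orthogonal_transformation f"
    and L: "f ` group_closure \<Phi> = group_closure \<Phi>"
  shows "f ` \<Phi> = \<Phi>"
proof -
  have "f \<alpha> \<in> \<Phi>" if "\<alpha> \<in> \<Phi>" for \<alpha>
  proof (rule lattice_norm2_root[OF \<Phi> norm2 S])
    show "f \<alpha> \<in> group_closure \<Phi>" using L that by (auto intro: group_closure.base)
    show "f \<alpha> \<bullet> f \<alpha> = 2" using f norm2[OF that] by (simp add: orthogonal_transformation_def)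
  qed
  then have "f ` \<Phi> \<subseteq> \<Phi>" by blast
  moreover have "inj_on f \<Phi>"
    using orthogonal_transformation_inj[OF f] inj_on_subset by blast
  moreover have "finite \<Phi>" using \<Phi> by (simp add: root_system_def)
  ultimately show ?thesis by (simp add: endo_inj_surj)
qed

section \<open>Families with a common Gram matrix\<close>

text \<open>The quadratic form of the Gram matrix at the coefficient vector is the squared norm of the
  linear combination.\<close>

lemma positive_definite_gram_independent:
  fixes A :: "int^'n^'n" and g :: "'n \<Rightarrow> 'v::real_inner"
  assumes A: "positive_definite A" "\<And>x y. of_int (A $ x $ y) = g x \<bullet> g y"
    and zero: "(\<Sum>x\<in>UNIV. u x *\<^sub>R g x) = 0"
  shows "u x = 0"
proof -
  define v :: "real^'n" where "v = (\<chi> x. u x)"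
  have "(\<Sum>x\<in>UNIV. \<Sum>y\<in>UNIV. v $ x * of_int (A $ x $ y) * v $ y)
      = (\<Sum>x\<in>UNIV. u x *\<^sub>R g x) \<bullet> (\<Sum>y\<in>UNIV. u y *\<^sub>R g y)"
    unfolding inner_sum_left inner_sum_right by (simp add: v_def A(2) mult_ac inner_commute)
  then have "v = 0" using A(1) zero unfolding positive_definite_def by fastforce
  then show ?thesis by (metis v_def vec_lambda_beta zero_index)
qed

lemma family_independent:
  fixes g :: "'n::finite \<Rightarrow> 'v::real_vector"
  assumes "\<And>u x. (\<Sum>x\<in>UNIV. u x *\<^sub>R g x) = 0 \<Longrightarrow> u x = 0"
  shows "inj g" "independent (range g)"
proof -
  show inj: "inj g"
  proof (rule injI, rule ccontr)
    fix x y assume "g x = g y" "x \<noteq> y"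
    define u :: "'n \<Rightarrow> real" where "u z = (if z = x then 1 else 0) - (if z = y then 1 else 0)" for z
    have "u z *\<^sub>R g z = (if z = x then g x else 0) - (if z = y then g y else 0)" for z
      by (auto simp: u_def)
    then have "(\<Sum>z\<in>UNIV. u z *\<^sub>R g z) = 0"
      using \<open>g x = g y\<close> by (simp add: sum_subtractf)
    then have "u x = 0" by (rule assms)
    then show False using \<open>x \<noteq> y\<close> by (simp add: u_def)
  qed
  show "independent (range g)"
  proof (rule independent_if_scalars_zero)
    fix f v assume "(\<Sum>x\<in>range g. f x *\<^sub>R x) = 0" "v \<in> range g"
    then show "f v = 0" using assms[of "\<lambda>x. f (g x)"] inj by (auto simp: sum.reindex)
  qed simp
qed

lemma isometry_of_equal_gram:
  fixes g h :: "'n::finite \<Rightarrow> 'v::euclidean_space"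
  assumes "inj g" "independent (range g)" "span (range g) = UNIV"
    and gram: "\<And>x y. g x \<bullet> g y = h x \<bullet> h y"
  obtains f where "orthogonal_transformation f" "\<And>x. f (g x) = h x"
proof -
  obtain f :: "'v \<Rightarrow> 'v" where f: "linear f" "\<forall>v\<in>range g. f v = h (inv_into UNIV g v)"
    using linear_independent_extend[OF assms(2), of "\<lambda>v. h (inv_into UNIV g v)"] by auto
  have fg: "f (g x) = h x" for x using f(2) assms(1) by simp
  have "f v \<bullet> f w = v \<bullet> w" for v w
  proof (rule bilinear_eq[where f = "\<lambda>v w. f v \<bullet> f w" and g = "\<lambda>v w. v \<bullet> w"
        and B = "range g" and C = "range g" and S = UNIV and T = UNIV])
    show "bilinear (\<lambda>v w. f v \<bullet> f w)"
      using f(1) by (auto simp: bilinear_def linear_iff inner_add_left inner_add_right)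
    show "bilinear (\<lambda>v w :: 'v. v \<bullet> w)"
      by (auto simp: bilinear_def linear_iff inner_add_left inner_add_right)
  qed (use assms(3) fg gram in auto)
  then have "orthogonal_transformation f" using f(1) by (simp add: orthogonal_transformation_def)
  then show ?thesis using fg by (rule that)
qed

section \<open>Companion bases\<close>

lemma companion_basis_image:
  assumes g: "companion_basis_giving_rise_to \<Phi> B A g"
    and f: "orthogonal_transformation f" "f ` \<Phi> = \<Phi>"
  shows "companion_basis_giving_rise_to \<Phi> B A (\<lambda>x. f (g x))"
proof -
  note lin = orthogonal_transformation_linear[OF f(1)]
  have r: "range (\<lambda>x. f (g x)) = f ` range g" by auto
  have "group_closure (range (\<lambda>x. f (g x))) = f ` group_closure (range g)"
    unfolding r by (rule group_closure_linear_image[OF lin])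
  also have "\<dots> = f ` group_closure \<Phi>"
    using g by (simp add: companion_basis_giving_rise_to_def Z_basis_def)
  also have "\<dots> = group_closure \<Phi>"
    using group_closure_linear_image[OF lin, of \<Phi>] f(2) by simp
  finally have closure: "group_closure (range (\<lambda>x. f (g x))) = group_closure \<Phi>" .
  have indep: "c x = 0" if "(\<Sum>x\<in>UNIV. of_int (c x) *\<^sub>R f (g x)) = 0" for c :: "_ \<Rightarrow> int" and x
  proof -
    have "f (\<Sum>x\<in>UNIV. of_int (c x) *\<^sub>R g x) = 0"
      using that by (simp add: linear_sum[OF lin] linear_scale[OF lin])
    then have "(\<Sum>x\<in>UNIV. of_int (c x) *\<^sub>R g x) = 0"
      using orthogonal_transformation_inj[OF f(1)] lin by (metis injD linear_0)
    then show ?thesis using g by (simp add: companion_basis_giving_rise_to_def Z_basis_def)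
  qed
  have "range (\<lambda>x. f (g x)) \<subseteq> \<Phi>"
    using g f(2) unfolding companion_basis_giving_rise_to_def by blast
  then show ?thesis
    using g f(1) closure indep
    by (auto simp: companion_basis_giving_rise_to_def Z_basis_def orthogonal_transformation_def)
qed

theorem theorem4p10:
  fixes \<Delta> :: dynkin
    and B A :: "int^'n^'n"
    and \<Phi> S :: "'v::euclidean_space set"
    and \<gamma> :: "'n \<Rightarrow> 'v"
  assumes "admissible \<Delta>"
    and "exchange_matrix_of_type \<Delta> B"
    and "root_system_of_type \<Delta> \<Phi>"
    and "\<And>\<alpha>. \<alpha> \<in> \<Phi> \<Longrightarrow> \<alpha> \<bullet> \<alpha> = 2"
    and "simple_system \<Phi> S"
    and "companion_basis_giving_rise_to \<Phi> B A \<gamma>"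
  shows "{\<gamma>'. companion_basis_giving_rise_to \<Phi> B A \<gamma>'} =
         {(\<lambda>x. w (\<sigma> (\<gamma> x))) | w \<sigma>.
            w \<in> weyl_group \<Phi> \<and> orthogonal_transformation \<sigma> \<and> bij_betw \<sigma> S S}"
proof (intro equalityI subsetI)
  note norm2 = assms(4) and S = assms(5) and \<gamma> = assms(6)
  have \<Phi>: "root_system \<Phi>" using assms(3) by (simp add: root_system_of_type_def)
  {
    fix \<gamma>' assume "\<gamma>' \<in> {\<gamma>'. companion_basis_giving_rise_to \<Phi> B A \<gamma>'}"
    then have \<gamma>': "companion_basis_giving_rise_to \<Phi> B A \<gamma>'" by simp
    have gram: "of_int (A $ x $ y) = \<gamma> x \<bullet> \<gamma> y" for x y
      using \<gamma> by (simp add: companion_basis_giving_rise_to_def)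
    have gram': "of_int (A $ x $ y) = \<gamma>' x \<bullet> \<gamma>' y" for x y
      using \<gamma>' by (simp add: companion_basis_giving_rise_to_def)
    have pos: "positive_definite A" using \<gamma> by (simp add: companion_basis_giving_rise_to_def)
    have L: "group_closure (range \<gamma>) = group_closure \<Phi>" "group_closure (range \<gamma>') = group_closure \<Phi>"
      using \<gamma> \<gamma>' by (auto simp: companion_basis_giving_rise_to_def Z_basis_def)
    have "\<Phi> \<subseteq> span (range \<gamma>)"
      using span_group_closure[of "range \<gamma>"] L by (auto intro: group_closure.base)
    then have "span \<Phi> \<subseteq> span (range \<gamma>)" by (metis span_mono span_span)
    then have sp: "span (range \<gamma>) = UNIV" using \<Phi> by (auto simp: root_system_def)
    have ind: "inj \<gamma>" "independent (range \<gamma>)"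
      by (rule family_independent, erule positive_definite_gram_independent[OF pos gram])+
    obtain \<rho> where \<rho>: "orthogonal_transformation \<rho>" "\<And>x. \<rho> (\<gamma> x) = \<gamma>' x"
      using isometry_of_equal_gram[OF ind sp, of \<gamma>'] gram gram' by metis
    note lin = orthogonal_transformation_linear[OF \<rho>(1)]
      and inj = orthogonal_transformation_inj[OF \<rho>(1)]
    have "range \<gamma>' = \<rho> ` range \<gamma>" by (simp add: image_image \<rho>(2))
    then have "\<rho> ` group_closure \<Phi> = group_closure \<Phi>"
      using group_closure_linear_image[OF lin, of "range \<gamma>"] L by simp
    then have "\<rho> ` \<Phi> = \<Phi>" using isometry_preserves_roots[OF \<Phi> norm2 S \<rho>(1)] by blast
    then have "simple_system \<Phi> (\<rho> ` S)" using simple_system_image[OF S lin inj] by blast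
    then obtain w where w: "w \<in> weyl_group \<Phi>" "w ` S = \<rho> ` S"
      using weyl_group_transitive_on_simple_systems[OF \<Phi> S] by metis
    have ow: "orthogonal_transformation w" using weyl_group_orthogonal[OF \<Phi> w(1)] by simp
    define \<sigma> where "\<sigma> = inv_into UNIV w \<circ> \<rho>"
    have o\<sigma>: "orthogonal_transformation \<sigma>"
      unfolding \<sigma>_def using ow \<rho>(1)
      by (intro orthogonal_transformation_compose orthogonal_transformation_inv)
    have "\<sigma> ` S = S"
      unfolding \<sigma>_def image_comp[symmetric] w(2)[symmetric]
      using orthogonal_transformation_inj[OF ow] by (simp add: image_inv_f_f)
    then have "bij_betw \<sigma> S S"
      using orthogonal_transformation_inj[OF o\<sigma>] by (auto simp: bij_betw_def intro: inj_on_subset)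
    moreover have "\<gamma>' = (\<lambda>x. w (\<sigma> (\<gamma> x)))"
      using \<rho>(2) orthogonal_transformation_surj[OF ow] by (auto simp: \<sigma>_def surj_f_inv_f)
    ultimately show "\<gamma>' \<in> {(\<lambda>x. w (\<sigma> (\<gamma> x))) | w \<sigma>.
        w \<in> weyl_group \<Phi> \<and> orthogonal_transformation \<sigma> \<and> bij_betw \<sigma> S S}"
      using w(1) o\<sigma> by blast
  next
    fix \<gamma>' assume "\<gamma>' \<in> {(\<lambda>x. w (\<sigma> (\<gamma> x))) | w \<sigma>.
        w \<in> weyl_group \<Phi> \<and> orthogonal_transformation \<sigma> \<and> bij_betw \<sigma> S S}"
    then obtain w \<sigma> where w: "w \<in> weyl_group \<Phi>" and \<sigma>: "orthogonal_transformation \<sigma>" "\<sigma> ` S = S"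
      and \<gamma>': "\<gamma>' = (\<lambda>x. w (\<sigma> (\<gamma> x)))"
      by (auto simp: bij_betw_def)
    have "\<sigma> ` group_closure \<Phi> = group_closure \<Phi>"
      using group_closure_linear_image[OF orthogonal_transformation_linear[OF \<sigma>(1)], of S] \<sigma>(2)
      by (simp add: simple_system_group_closure[OF S])
    then have "\<sigma> ` \<Phi> = \<Phi>" using isometry_preserves_roots[OF \<Phi> norm2 S \<sigma>(1)] by blast
    then have "companion_basis_giving_rise_to \<Phi> B A (\<lambda>x. \<sigma> (\<gamma> x))"
      by (rule companion_basis_image[OF \<gamma> \<sigma>(1)])
    then show "\<gamma>' \<in> {\<gamma>'. companion_basis_giving_rise_to \<Phi> B A \<gamma>'}"
      using companion_basis_image weyl_group_orthogonal[OF \<Phi> w] unfolding \<gamma>' by blast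
  }
qed

end
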